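(* Let $M$ be a matroid on a finite set $E$ with rank function $r$, and let $\ell:E\to\mathbb{N}$ and $W:E\to\mathbb{N}$ be fixed functions. The following are equivalent: (1) for every list assignment $L$ of size $\ell$, $M$ is $W$-colorable from $L$; (2) $M$ is $W$-colorable from the lists $\mathbf{L}(e)=\{1,\dots,\ell(e)\}$; (3) for every $A\subseteq E$, $\sum_{i\in\mathbb{N}_+} r(\{e\in A:\ell(e)\ge i\})\ge \sum_{e\in A}W(e)$.
   Context: A list assignment is a function $L:E\to\mathcal{P}(\mathbb{N})$; it has size $\ell$ if $|L(e)|=\ell(e)$ for every $e\in E$. $M$ is $W$-colorable from lists $L$ if one can choose for each $e\in E$ a set $L'(e)\subseteq L(e)$ of exactly $W(e)$ colors such that, for every color $c$, the set $\{e\in E: c\in L'(e)\}$ is independent in $M$. *)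

theory Defs
  imports "HOL-Analysis.Analysis"
begin

locale matroid =
  fixes E :: "'a set" and indep :: "'a set \<Rightarrow> bool"
  assumes finite_ground: "finite E"
    and indep_subset_ground: "indep X \<Longrightarrow> X \<subseteq> E"
    and indep_empty: "indep {}"
    and indep_mono: "indep X \<Longrightarrow> Y \<subseteq> X \<Longrightarrow> indep Y"
    and augmentation: "indep X \<Longrightarrow> indep Y \<Longrightarrow> card X < card Y \<Longrightarrow>
          \<exists>y \<in> Y - X. indep (insert y X)"

definition matroid_rank :: "('a set \<Rightarrow> bool) \<Rightarrow> 'a set \<Rightarrow> nat" where
  "matroid_rank indep A = Max (card ` {X. X \<subseteq> A \<and> indep X})"

text \<open>
  A list assignment is a function \<open>L :: 'a \<Rightarrow> nat set\<close>, of which only the values on \<open>E\<close> matter.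
  Finiteness is stated separately in the next two definitions because \<open>card\<close> is \<open>0\<close> on
  infinite sets.
\<close>

definition has_list_size :: "'a set \<Rightarrow> ('a \<Rightarrow> nat set) \<Rightarrow> ('a \<Rightarrow> nat) \<Rightarrow> bool" where
  "has_list_size E L l \<longleftrightarrow> (\<forall>e\<in>E. finite (L e) \<and> card (L e) = l e)"

definition colorable_from ::
  "'a set \<Rightarrow> ('a set \<Rightarrow> bool) \<Rightarrow> ('a \<Rightarrow> nat) \<Rightarrow> ('a \<Rightarrow> nat set) \<Rightarrow> bool" where
  "colorable_from E indep W L \<longleftrightarrow>
     (\<exists>L'. (\<forall>e\<in>E. L' e \<subseteq> L e \<and> finite (L' e) \<and> card (L' e) = W e) \<and>
           (\<forall>c. indep {e \<in> E. c \<in> L' e}))"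

end

theory Submission
  imports Defs
begin

text \<open>
  The implication from (3) to (1) combines two facts. First, if \<open>B \<subseteq> A\<close> is independent and greedy
  for \<open>l\<close>, i.e. it meets each level set \<open>{e \<in> A. l e \<ge> i}\<close> in a basis of that set, then for every
  list assignment \<open>L\<close> of size \<open>l\<close> counting the pairs \<open>(e, c)\<close> with \<open>e \<in> B\<close>, \<open>c \<in> L e\<close> gives
  \<open>\<Sum>\<^sub>c r {e \<in> A. c \<in> L e} \<ge> \<Sum>\<^sub>e\<^sub>\<in>\<^sub>B l e = \<Sum>\<^sub>i r {e \<in> A. l e \<ge> i}\<close>, so (3) implies the inequality
  \<open>\<Sum>\<^sub>c r {e \<in> A. c \<in> L e} \<ge> \<Sum>\<^sub>e\<^sub>\<in>\<^sub>A W e\<close>. Second, this is Rado's condition for an independent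
  transversal, in the direct sum of one copy of the matroid per colour, of the family that contains
  \<open>W e\<close> copies of \<open>{e} \<times> L e\<close> for each \<open>e\<close>; such a transversal is a colouring.
\<close>

section \<open>Double counting and transversals for submodular functions\<close>

lemma sum_card_fibres:
  assumes "finite A" "finite C" "\<And>e. e \<in> A \<Longrightarrow> L e \<subseteq> C"
  shows "(\<Sum>c\<in>C. card {e \<in> A. c \<in> L e}) = (\<Sum>e\<in>A. card (L e))"
proof -
  have "(\<Sum>e\<in>A. card (L e)) = (\<Sum>e\<in>A. card {c \<in> C. c \<in> L e})"
    using assms(3) by (intro sum.cong refl arg_cong[where f = card]) auto
  also have "\<dots> = (\<Sum>c\<in>C. card {e \<in> A. c \<in> L e})"
    using sum_multicount_gen[OF assms(1,2), of "\<lambda>e c. c \<in> L e" "\<lambda>c. card {e \<in> A. c \<in> L e}"] by simp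
  finally show ?thesis by simp
qed

text \<open>
  Welsh's form of Rado's theorem. If deleting \<open>a\<close> and deleting \<open>b\<close> from the same member \<open>F j\<close> both
  violated the condition, uncrossing the two violating subfamilies would violate it for \<open>F\<close>.
\<close>
lemma submodular_transversal:
  fixes f :: "'b set \<Rightarrow> nat" and F :: "'j \<Rightarrow> 'b set"
  assumes "finite J" "\<And>j. j \<in> J \<Longrightarrow> finite (F j)"
    and empty: "f {} = 0"
    and mono: "\<And>X Y. X \<subseteq> Y \<Longrightarrow> f X \<le> f Y"
    and submod: "\<And>X Y. f (X \<union> Y) + f (X \<inter> Y) \<le> f X + f Y"
    and "\<And>K. K \<subseteq> J \<Longrightarrow> card K \<le> f (\<Union>j\<in>K. F j)"
  shows "\<exists>x. (\<forall>j\<in>J. x j \<in> F j) \<and> card J \<le> f (x ` J)"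
  using assms(2,6)
proof (induction "\<Sum>j\<in>J. card (F j)" arbitrary: F rule: less_induct)
  case less
  note cond = less.prems(2)
  have ne: "F j \<noteq> {}" if "j \<in> J" for j
    using cond[of "{j}"] that empty by auto
  show ?case
  proof (cases "\<exists>j\<in>J. \<exists>a\<in>F j. \<exists>b\<in>F j. a \<noteq> b")
    case False
    \<comment> \<open>All members are singletons here, so choosing their elements already exhausts
      the union.\<close>
    define x where "x j = (SOME a. a \<in> F j)" for j
    have x: "x j \<in> F j" if "j \<in> J" for j
      using ne[OF that] unfolding x_def by (simp add: some_in_eq)
    have "(\<Union>j\<in>J. F j) \<subseteq> x ` J"
      using x False by blast
    then have "card J \<le> f (x ` J)"
      using cond[OF subset_refl] mono le_trans by metis
    then show ?thesis
      using x by blast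
  next
    case True
    then obtain j a b where j: "j \<in> J" "a \<in> F j" "b \<in> F j" "a \<noteq> b" by blast
    \<comment> \<open>\<open>G a\<close> is the family with \<open>a\<close> deleted from the one
      member \<open>F j\<close>. If some such deletion keeps the condition, induction on the total
      size finishes.\<close>
    define G where "G a = F(j := F j - {a})" for a
    have fallback: ?thesis if a: "a \<in> F j" and G: "\<And>K. K \<subseteq> J \<Longrightarrow> card K \<le> f (\<Union>i\<in>K. G a i)" for a
    proof -
      have "card (G a j) < card (F j)"
        using card_Diff1_less[OF less.prems(1)[OF j(1)] a] by (simp add: G_def)
      then have "(\<Sum>i\<in>J. card (G a i)) < (\<Sum>i\<in>J. card (F i))"
        using j(1) assms(1) by (intro sum_strict_mono_ex1) (auto simp: G_def)
      moreover have "finite (G a i)" if "i \<in> J" for i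
        using less.prems(1)[OF that] unfolding G_def by auto
      ultimately obtain x where "\<forall>i\<in>J. x i \<in> G a i" "card J \<le> f (x ` J)"
        using less.hyps[of "G a"] G by blast
      moreover have "G a i \<subseteq> F i" for i
        unfolding G_def by auto
      ultimately show ?thesis by blast
    qed
    have viol: "j \<in> K" if "K \<subseteq> J" "\<not> card K \<le> f (\<Union>i\<in>K. G a i)" for K a
    proof (rule ccontr)
      assume "j \<notin> K"
      then have "(\<Union>i\<in>K. G a i) = (\<Union>i\<in>K. F i)"
        unfolding G_def by auto
      then show False using cond that by metis
    qed
    show ?thesis
    proof (rule ccontr)
      assume "\<not> ?thesis"
      then obtain K1 K2 where K: "K1 \<subseteq> J" "\<not> card K1 \<le> f (\<Union>i\<in>K1. G a i)"
          "K2 \<subseteq> J" "\<not> card K2 \<le> f (\<Union>i\<in>K2. G b i)"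
        using fallback j(2,3) by meson
      define U1 U2 where "U1 = (\<Union>i\<in>K1. G a i)" and "U2 = (\<Union>i\<in>K2. G b i)"
      have jK: "j \<in> K1" "j \<in> K2" using viol K by blast+
      have fin: "finite K1" "finite K2" using K assms(1) finite_subset by blast+
      \<comment> \<open>Both subfamilies contain \<open>j\<close>, and as \<open>a\<close> differs
        from \<open>b\<close>, each element of \<open>F j\<close> survives one of the two
        deletions.\<close>
      have "(\<Union>i\<in>K1 \<union> K2. F i) \<subseteq> U1 \<union> U2"
      proof
        fix y assume "y \<in> (\<Union>i\<in>K1 \<union> K2. F i)"
        then obtain i where i: "i \<in> K1 \<union> K2" "y \<in> F i" by blast
        show "y \<in> U1 \<union> U2"
        proof (cases "i = j")
          case True
          then have "y \<in> G a j \<or> y \<in> G b j"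
            using i j(4) unfolding G_def by auto
          then show ?thesis using jK unfolding U1_def U2_def by blast
        next
          case False
          then have "y \<in> G a i" "y \<in> G b i"
            using i unfolding G_def by auto
          then show ?thesis using i unfolding U1_def U2_def by blast
        qed
      qed
      then have 1: "card (K1 \<union> K2) \<le> f (U1 \<union> U2)"
        using cond[of "K1 \<union> K2"] K mono by (meson le_sup_iff order_trans)
      \<comment> \<open>\<open>F j\<close> may fail to lie in \<open>U1 \<inter> U2\<close>, so
        \<open>j\<close> is dropped. This costs 1, whereas the two strict violations together gain
        2, which gives the contradiction.\<close>
      have "(\<Union>i\<in>K1 \<inter> K2 - {j}. F i) \<subseteq> U1 \<inter> U2"
        unfolding U1_def U2_def G_def by fastforce
      then have "card (K1 \<inter> K2 - {j}) \<le> f (U1 \<inter> U2)"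
        using cond[of "K1 \<inter> K2 - {j}"] K mono by (meson Diff_subset inf.coboundedI1 order_trans)
      moreover have "card (K1 \<inter> K2) = Suc (card (K1 \<inter> K2 - {j}))"
        using jK fin by (intro card.remove) auto
      moreover have "card (K1 \<union> K2) + card (K1 \<inter> K2) = card K1 + card K2"
        using card_Un_Int[OF fin] by simp
      ultimately show False
        using 1 submod[of U1 U2] K(2,4) unfolding U1_def[symmetric] U2_def[symmetric] by linarith
    qed
  qed
qed

section \<open>The rank function: extension to bases and submodularity\<close>

context matroid
begin

abbreviation rank :: "'a set \<Rightarrow> nat" where
  "rank \<equiv> matroid_rank indep"

lemma finite_indep_subsets: "finite {X. X \<subseteq> A \<and> indep X}"
  by (rule finite_subset[of _ "Pow E"]) (use indep_subset_ground finite_ground in auto)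

lemma indep_finite: "indep X \<Longrightarrow> finite X"
  using indep_subset_ground finite_ground finite_subset by blast

lemma card_le_rank: "indep X \<Longrightarrow> X \<subseteq> A \<Longrightarrow> card X \<le> rank A"
  unfolding matroid_rank_def using finite_indep_subsets[of A] by (intro Max_ge) auto

lemma rank_witness:
  obtains X where "X \<subseteq> A" "indep X" "card X = rank A"
proof -
  have "rank A \<in> card ` {X. X \<subseteq> A \<and> indep X}"
    unfolding matroid_rank_def using finite_indep_subsets[of A] indep_empty
    by (intro Max_in) auto
  then show ?thesis using that by auto
qed

lemma rank_mono: "A \<subseteq> B \<Longrightarrow> rank A \<le> rank B"
  by (metis rank_witness card_le_rank subset_trans)

lemma rank_empty: "rank {} = 0"
  by (metis rank_witness card.empty subset_empty)

lemma rank_le_card: "finite A \<Longrightarrow> rank A \<le> card A"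
  by (metis rank_witness card_mono)

lemma indep_if_rank_eq_card: "finite A \<Longrightarrow> rank A = card A \<Longrightarrow> indep A"
  by (metis rank_witness card_subset_eq)

text \<open>Augmentation from a maximum independent subset of \<open>A\<close> adds one element at a
  time; the induction is on the missing rank.\<close>

lemma basis_extension:
  assumes "indep B" "B \<subseteq> A"
  obtains D where "B \<subseteq> D" "D \<subseteq> A" "indep D" "card D = rank A"
proof -
  have "\<exists>D. B \<subseteq> D \<and> D \<subseteq> A \<and> indep D \<and> card D = rank A"
    using assms
  proof (induction "rank A - card B" arbitrary: B rule: less_induct)
    case less
    show ?case
    proof (cases "card B = rank A")
      case True
      then show ?thesis using less.prems by blast
    next
      case False
      then have lt: "card B < rank A"
        using card_le_rank[OF less.prems] by simp
      obtain X where X: "X \<subseteq> A" "indep X" "card X = rank A" by (rule rank_witness)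
      then obtain y where y: "y \<in> X - B" "indep (insert y B)"
        using augmentation less.prems lt by metis
      then have "card (insert y B) = Suc (card B)"
        using indep_finite[OF less.prems(1)] by simp
      then have "rank A - card (insert y B) < rank A - card B"
        using lt by simp
      moreover have "insert y B \<subseteq> A"
        using y(1) X(1) less.prems(2) by blast
      ultimately have "\<exists>D. insert y B \<subseteq> D \<and> D \<subseteq> A \<and> indep D \<and> card D = rank A"
        using y(2) by (intro less.hyps)
      then show ?thesis by auto
    qed
  qed
  then show ?thesis using that by blast
qed

text \<open>Extend a basis of \<open>X \<inter> Y\<close> to a basis \<open>D\<close> of
  \<open>X \<union> Y\<close> and apply inclusion-exclusion to the independent sets
  \<open>D \<inter> X\<close> and \<open>D \<inter> Y\<close>.\<close>

lemma rank_submodular: "rank (X \<union> Y) + rank (X \<inter> Y) \<le> rank X + rank Y"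
proof -
  obtain B where B: "B \<subseteq> X \<inter> Y" "indep B" "card B = rank (X \<inter> Y)" by (rule rank_witness)
  obtain D where D: "B \<subseteq> D" "D \<subseteq> X \<union> Y" "indep D" "card D = rank (X \<union> Y)"
    using basis_extension[of B "X \<union> Y"] B by blast
  have fin: "finite D" using D indep_finite by blast
  have "D \<inter> X \<union> D \<inter> Y = D" using D by blast
  then have "card (D \<inter> X) + card (D \<inter> Y) = card D + card (D \<inter> X \<inter> (D \<inter> Y))"
    using card_Un_Int[of "D \<inter> X" "D \<inter> Y"] fin by simp
  moreover have "card B \<le> card (D \<inter> X \<inter> (D \<inter> Y))"
    using fin B D by (intro card_mono) auto
  moreover have "card (D \<inter> X) \<le> rank X" "card (D \<inter> Y) \<le> rank Y"
    using D indep_mono by (auto intro!: card_le_rank)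
  ultimately show ?thesis using B D by linarith
qed

section \<open>Greedy bases and level sets\<close>

text \<open>Built from the highest level downwards: a basis of one level set extends to a basis of
  the next larger one, and the extension cannot spoil the higher levels, where the rank is already
  attained.\<close>

lemma greedy_basis:
  fixes l :: "'a \<Rightarrow> nat"
  assumes "finite A"
  obtains B where "indep B" "B \<subseteq> A" "\<And>i. card {e \<in> B. l e \<ge> i} = rank {e \<in> A. l e \<ge> i}"
proof -
  \<comment> \<open>The strict bound makes level \<open>N\<close> empty, so the descent starts from
    the empty set. At \<open>k = N\<close> every threshold is covered, including 0.\<close>
  obtain N where N: "\<forall>e\<in>A. l e < N"
    using finite_nat_set_iff_bounded[of "l ` A"] assms by auto
  have "\<exists>B. indep B \<and> B \<subseteq> {e \<in> A. l e \<ge> N - k} \<and>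
      (\<forall>i \<ge> N - k. card {e \<in> B. l e \<ge> i} = rank {e \<in> A. l e \<ge> i})" for k
  proof (induction k)
    case 0
    have "{e \<in> A. l e \<ge> i} = {}" if "i \<ge> N" for i
      using N that by force
    then have "rank {e \<in> A. l e \<ge> i} = 0" if "i \<ge> N" for i
      using that rank_empty by presburger
    then show ?case
      by (intro exI[of _ "{}"]) (simp add: indep_empty)
  next
    case (Suc k)
    then obtain B where B: "indep B" "B \<subseteq> {e \<in> A. l e \<ge> N - k}"
      "\<And>i. i \<ge> N - k \<Longrightarrow> card {e \<in> B. l e \<ge> i} = rank {e \<in> A. l e \<ge> i}" by blast
    have "B \<subseteq> {e \<in> A. l e \<ge> N - Suc k}"
      using B(2) by auto
    then obtain D where D: "B \<subseteq> D" "D \<subseteq> {e \<in> A. l e \<ge> N - Suc k}" "indep D"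
      "card D = rank {e \<in> A. l e \<ge> N - Suc k}"
      using basis_extension B(1) by blast
    have fin: "finite D" using D indep_finite by blast
    have "card {e \<in> D. l e \<ge> i} = rank {e \<in> A. l e \<ge> i}" if i: "i \<ge> N - Suc k" for i
    proof (cases "i = N - Suc k")
      case True
      then have "{e \<in> D. l e \<ge> i} = D" using D(2) by auto
      then show ?thesis using D(4) True by simp
    next
      case False
      then have "i \<ge> N - k" using i by linarith
      then have "rank {e \<in> A. l e \<ge> i} = card {e \<in> B. l e \<ge> i}" using B(3) by simp
      also have "\<dots> \<le> card {e \<in> D. l e \<ge> i}"
        using D(1) fin by (intro card_mono) auto
      finally show ?thesis
        using D(2) by (intro antisym card_le_rank) (auto intro: indep_mono[OF D(3)])
    qed
    then show ?case using D by blast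
  qed
  from this[of N] show ?thesis using that by auto
qed

text \<open>Both sides are compared with the sum of \<open>l e\<close> over a greedy basis
  \<open>B\<close>: the left side equals it by double counting with the lists
  \<open>{1..l e}\<close>, and the right side is at least as large because
  \<open>{e \<in> B. c \<in> L e}\<close> is independent for each \<open>c\<close>.\<close>

lemma rank_level_sum_le:
  assumes "finite A" "finite C" "\<And>e. e \<in> A \<Longrightarrow> L e \<subseteq> C"
    and card_L: "\<And>e. e \<in> A \<Longrightarrow> card (L e) = l e" and N: "\<And>e. e \<in> A \<Longrightarrow> l e \<le> N"
  shows "(\<Sum>i=1..N. rank {e \<in> A. l e \<ge> i}) \<le> (\<Sum>c\<in>C. rank {e \<in> A. c \<in> L e})"
proof -
  obtain B where B: "indep B" "B \<subseteq> A" "\<And>i. card {e \<in> B. l e \<ge> i} = rank {e \<in> A. l e \<ge> i}"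
    using greedy_basis[OF assms(1)] by metis
  have fin: "finite B" using B indep_finite by blast
  have "{e \<in> B. l e \<ge> i} = {e \<in> B. i \<in> {1..l e}}" if "i \<in> {1..N}" for i
    using that by auto
  then have "(\<Sum>i=1..N. rank {e \<in> A. l e \<ge> i}) = (\<Sum>i\<in>{1..N}. card {e \<in> B. i \<in> {1..l e}})"
    using B(3) by (metis (mono_tags, lifting) sum.cong)
  also have "\<dots> = (\<Sum>e\<in>B. card {1..l e})"
    using fin B N by (intro sum_card_fibres) auto
  also have "\<dots> = (\<Sum>e\<in>B. card (L e))"
    using B card_L by (intro sum.cong) auto
  also have "\<dots> = (\<Sum>c\<in>C. card {e \<in> B. c \<in> L e})"
    using fin B assms(2,3) by (intro sum_card_fibres[symmetric]) auto
  also have "\<dots> \<le> (\<Sum>c\<in>C. rank {e \<in> A. c \<in> L e})"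
    using B by (intro sum_mono card_le_rank) (auto intro: indep_mono[OF B(1)])
  finally show ?thesis .
qed

section \<open>Colorings from independent transversals\<close>

lemma colorable_if_rank_sum_ge:
  assumes fin: "finite C" and LC: "\<And>e. e \<in> E \<Longrightarrow> L e \<subseteq> C"
    and cond: "\<And>A. A \<subseteq> E \<Longrightarrow> (\<Sum>e\<in>A. W e) \<le> (\<Sum>c\<in>C. rank {e \<in> A. c \<in> L e})"
  shows "colorable_from E indep W L"
proof -
  \<comment> \<open>\<open>J\<close> holds \<open>W e\<close> copies of each \<open>e\<close>, all
    with the same member \<open>{e} \<times> L e\<close>. \<open>f\<close> is the rank in the direct
    sum of one copy of the matroid per color in \<open>C\<close>.\<close>
  define J where "J = (SIGMA e:E. {..<W e})"
  define F where "F p = {fst p} \<times> L (fst p)" for p :: "'a \<times> nat"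
  define f where "f X = (\<Sum>c\<in>C. rank {e. (e, c) \<in> X})" for X
  have finJ: "finite J"
    unfolding J_def using finite_ground by auto
  have "\<exists>x. (\<forall>j\<in>J. x j \<in> F j) \<and> card J \<le> f (x ` J)"
  proof (rule submodular_transversal[OF finJ])
    show "finite (F j)" if "j \<in> J" for j
      using that finite_subset[OF LC fin] unfolding J_def F_def by auto
    show "f {} = 0"
      unfolding f_def by (simp add: rank_empty)
    show "f X \<le> f Y" if "X \<subseteq> Y" for X Y
      unfolding f_def using that by (intro sum_mono rank_mono) auto
    show "f (X \<union> Y) + f (X \<inter> Y) \<le> f X + f Y" for X Y
      unfolding f_def sum.distrib[symmetric]
    proof (rule sum_mono)
      fix c
      show "rank {e. (e, c) \<in> X \<union> Y} + rank {e. (e, c) \<in> X \<inter> Y}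
        \<le> rank {e. (e, c) \<in> X} + rank {e. (e, c) \<in> Y}"
        using rank_submodular[of "{e. (e, c) \<in> X}" "{e. (e, c) \<in> Y}"]
        by (simp add: Collect_disj_eq Collect_conj_eq)
    qed
    show "card K \<le> f (\<Union>j\<in>K. F j)" if K: "K \<subseteq> J" for K
    proof -
      define A where "A = fst ` K"
      have A: "A \<subseteq> E" using K unfolding A_def J_def by auto
      have finA: "finite A" using A finite_ground finite_subset by blast
      \<comment> \<open>Adding all copies of the elements of \<open>A\<close> leaves the union of
        the members unchanged, so bounding this largest case suffices.\<close>
      have "K \<subseteq> (SIGMA e:A. {..<W e})"
        using K unfolding A_def J_def by force
      then have "card K \<le> card (SIGMA e:A. {..<W e})"
        using finA by (intro card_mono) auto
      also have "\<dots> = (\<Sum>e\<in>A. W e)"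
        using finA by (simp add: card_SigmaI)
      also have "\<dots> \<le> (\<Sum>c\<in>C. rank {e \<in> A. c \<in> L e})"
        using cond A by blast
      also have "\<dots> = f (\<Union>j\<in>K. F j)"
        unfolding f_def A_def F_def
        by (intro sum.cong refl arg_cong[where f = rank]) force
      finally show ?thesis .
    qed
  qed
  then obtain x where x: "\<And>j. j \<in> J \<Longrightarrow> x j \<in> F j" "card J \<le> f (x ` J)" by blast
  define X where "X = x ` J"
  have finX: "finite X" unfolding X_def using finJ by simp
  have XC: "snd p \<in> L (fst p) \<and> fst p \<in> E" if "p \<in> X" for p
    using that x(1) unfolding X_def J_def F_def by fastforce
  have slice_fin: "finite {e. (e, c) \<in> X}" for c
    by (rule finite_subset[of _ "fst ` X"]) (use finX in force)+
  have slice_le: "rank {e. (e, c) \<in> X} \<le> card {e. (e, c) \<in> X}" for c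
    using slice_fin by (rule rank_le_card)
  have "card X = card (SIGMA c:C. {e. (e, c) \<in> X})"
  proof (rule bij_betw_same_card[of prod.swap])
    show "bij_betw prod.swap X (SIGMA c:C. {e. (e, c) \<in> X})"
      using XC LC by (intro bij_betw_byWitness[where f' = prod.swap]) fastforce+
  qed
  then have cardX: "card X = (\<Sum>c\<in>C. card {e. (e, c) \<in> X})"
    using fin slice_fin by (simp add: card_SigmaI)
  \<comment> \<open>The chain \<open>f X \<le> card X \<le> card J \<le> f X\<close> collapses to
    equalities. Hence \<open>x\<close> is injective, so the copies of one element get distinct
    colors, and each color slice of \<open>X\<close> has rank equal to its size, so it is
    independent.\<close>
  have "f X \<le> card X"
    unfolding f_def cardX using slice_le by (rule sum_mono)
  moreover have "card X \<le> card J"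
    unfolding X_def using finJ by (rule card_image_le)
  ultimately have eq: "card X = card J" "f X = card X"
    using x(2) unfolding X_def by auto
  have inj: "inj_on x J"
    using eq(1) finJ unfolding X_def by (intro eq_card_imp_inj_on)
  have indep_C: "indep {e. (e, c) \<in> X}" if "c \<in> C" for c
  proof (rule indep_if_rank_eq_card[OF slice_fin])
    show "rank {e. (e, c) \<in> X} = card {e. (e, c) \<in> X}"
      using eq(2) slice_le that fin unfolding f_def cardX
      by (intro sum_mono_inv[of "\<lambda>c. rank {e. (e, c) \<in> X}" C])
  qed
  define L' where "L' e = {c. (e, c) \<in> X}" for e
  have "card (L' e) = W e \<and> finite (L' e) \<and> L' e \<subseteq> L e" if e: "e \<in> E" for e
  proof -
    \<comment> \<open>The chosen pair for the copy \<open>(e, i)\<close> has first component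
      \<open>e\<close>, so the copies of \<open>e\<close> enumerate exactly the colors in
      \<open>L' e\<close>.\<close>
    have "bij_betw (\<lambda>i. snd (x (e, i))) {..<W e} (L' e)"
      unfolding bij_betw_def
    proof
      have fst_x: "fst (x (e', i)) = e'" if "e' \<in> E" "i < W e'" for e' i
        using x(1)[of "(e', i)"] that unfolding J_def F_def by auto
      show "inj_on (\<lambda>i. snd (x (e, i))) {..<W e}"
      proof (rule inj_onI)
        fix i i' assume "i \<in> {..<W e}" "i' \<in> {..<W e}" "snd (x (e, i)) = snd (x (e, i'))"
        then have "x (e, i) = x (e, i')" "(e, i) \<in> J" "(e, i') \<in> J"
          using fst_x e by (auto simp: prod_eq_iff J_def)
        then show "i = i'" using inj by (auto dest: inj_onD)
      qed
      show "(\<lambda>i. snd (x (e, i))) ` {..<W e} = L' e"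
      proof
        show "(\<lambda>i. snd (x (e, i))) ` {..<W e} \<subseteq> L' e"
        proof clarsimp
          fix i assume i: "i < W e"
          have "(e, snd (x (e, i))) = x (e, i)"
            using fst_x[OF e i] by (simp add: prod_eq_iff)
          then show "snd (x (e, i)) \<in> L' e"
            using e i unfolding L'_def X_def J_def by auto
        qed
        show "L' e \<subseteq> (\<lambda>i. snd (x (e, i))) ` {..<W e}"
        proof
          fix c assume "c \<in> L' e"
          then obtain e' i where i: "e' \<in> E" "i < W e'" "(e, c) = x (e', i)"
            unfolding L'_def X_def J_def by auto
          then have "e' = e" "c = snd (x (e', i))"
            using fst_x by (metis fst_conv snd_conv)+
          then show "c \<in> (\<lambda>i. snd (x (e, i))) ` {..<W e}"
            using i by blast
        qed
      qed
    qed
    moreover have "L' e \<subseteq> L e"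
      using XC unfolding L'_def by force
    ultimately show ?thesis
      using bij_betw_same_card bij_betw_finite by fastforce
  qed
  moreover have "indep {e \<in> E. c \<in> L' e}" for c
  proof -
    have eq: "{e \<in> E. c \<in> L' e} = {e. (e, c) \<in> X}"
      using XC unfolding L'_def by force
    show ?thesis
    proof (cases "c \<in> C")
      case True
      then show ?thesis using indep_C eq by simp
    next
      case False
      then have "{e. (e, c) \<in> X} = {}"
        using XC LC by force
      then show ?thesis unfolding eq using indep_empty by simp
    qed
  qed
  ultimately show ?thesis
    unfolding colorable_from_def by blast
qed

section \<open>The level sum and its necessity for coloring\<close>

text \<open>Levels above \<open>N\<close> are empty, so the sum has finite support and is not the
  default 0 of a non-summable family.\<close>

lemma rank_level_infsum:
  fixes l :: "'a \<Rightarrow> nat"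
  assumes "\<And>e. e \<in> A \<Longrightarrow> l e \<le> N"
  shows "(\<Sum>\<^sub>\<infinity>i\<in>{1..}. rank {e \<in> A. l e \<ge> i}) = (\<Sum>i=1..N. rank {e \<in> A. l e \<ge> i})"
proof -
  have "{e \<in> A. l e \<ge> i} = {}" if "i \<in> {1..} - {1..N}" for i
    using that by (auto dest!: assms)
  then have "(\<Sum>\<^sub>\<infinity>i\<in>{1..}. rank {e \<in> A. l e \<ge> i}) = (\<Sum>\<^sub>\<infinity>i\<in>{1..N}. rank {e \<in> A. l e \<ge> i})"
    using rank_empty by (intro infsum_cong_neutral) (auto simp del: Collect_empty_eq)
  then show ?thesis by simp
qed

text \<open>Within \<open>A\<close>, the class of color \<open>i\<close> is independent and lies in
  the level set of \<open>i\<close>, since \<open>i \<in> {1..l e}\<close> forces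
  \<open>l e \<ge> i\<close>. Summing the class sizes over \<open>i\<close> gives the total
  weight.\<close>

lemma weight_le_level_sum_if_colorable:
  assumes col: "colorable_from E indep W (\<lambda>e. {1..l e})" and A: "A \<subseteq> E"
    and N: "\<And>e. e \<in> A \<Longrightarrow> l e \<le> N"
  shows "(\<Sum>e\<in>A. W e) \<le> (\<Sum>i=1..N. rank {e \<in> A. l e \<ge> i})"
proof -
  obtain L' where L': "\<And>e. e \<in> E \<Longrightarrow> L' e \<subseteq> {1..l e} \<and> card (L' e) = W e"
    and ind: "\<And>c. indep {e \<in> E. c \<in> L' e}"
    using col unfolding colorable_from_def by blast
  have sub: "L' e \<subseteq> {1..l e}" if "e \<in> A" for e
    using L' A that by blast
  have "(\<Sum>e\<in>A. W e) = (\<Sum>e\<in>A. card (L' e))"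
    using L' A by (intro sum.cong) auto
  also have "\<dots> = (\<Sum>i=1..N. card {e \<in> A. i \<in> L' e})"
    using finite_subset[OF A finite_ground] sub N
    by (intro sum_card_fibres[symmetric]) fastforce+
  also have "\<dots> \<le> (\<Sum>i=1..N. rank {e \<in> A. l e \<ge> i})"
    using sub A by (intro sum_mono card_le_rank) (force intro: indep_mono[OF ind])+
  finally show ?thesis .
qed

end

theorem theorem4:
  fixes E :: "'a set" and indep :: "'a set \<Rightarrow> bool" and l W :: "'a \<Rightarrow> nat"
  assumes "matroid E indep"
  shows "((\<forall>L. has_list_size E L l \<longrightarrow> colorable_from E indep W L) \<longleftrightarrow>
            colorable_from E indep W (\<lambda>e. {1..l e}))
       \<and> (colorable_from E indep W (\<lambda>e. {1..l e}) \<longleftrightarrow>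
            (\<forall>A\<subseteq>E. (\<Sum>\<^sub>\<infinity>i\<in>{1..}. matroid_rank indep {e \<in> A. l e \<ge> i}) \<ge> (\<Sum>e\<in>A. W e)))"
    (is "(?all \<longleftrightarrow> ?initial) \<and> (_ \<longleftrightarrow> ?ineq)")
proof -
  interpret matroid E indep by (rule assms)
  \<comment> \<open>Any common bound for \<open>l\<close> on \<open>E\<close> would do; it truncates
    the level sums of all subsets at the same index.\<close>
  define N where "N = (\<Sum>e\<in>E. l e)"
  have N: "l e \<le> N" if "e \<in> E" for e
    unfolding N_def using that finite_ground by (intro member_le_sum) auto
  have level: "(\<Sum>\<^sub>\<infinity>i\<in>{1..}. rank {e \<in> A. l e \<ge> i}) = (\<Sum>i=1..N. rank {e \<in> A. l e \<ge> i})"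
    if "A \<subseteq> E" for A
    using that N by (intro rank_level_infsum) auto
  have "?initial" if ?all
    using that by (simp add: has_list_size_def)
  moreover have "?ineq" if ?initial
  proof (intro allI impI)
    fix A assume A: "A \<subseteq> E"
    show "(\<Sum>\<^sub>\<infinity>i\<in>{1..}. rank {e \<in> A. l e \<ge> i}) \<ge> (\<Sum>e\<in>A. W e)"
      unfolding level[OF A] using A N by (intro weight_le_level_sum_if_colorable[OF that]) auto
  qed
  moreover have "?all" if ineq: ?ineq
  proof (intro allI impI)
    fix L assume size: "has_list_size E L l"
    define C where "C = (\<Union>e\<in>E. L e)"
    have "finite C"
      using size finite_ground unfolding C_def has_list_size_def by auto
    then show "colorable_from E indep W L"
    proof (rule colorable_if_rank_sum_ge)
      show "L e \<subseteq> C" if "e \<in> E" for e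
        using that unfolding C_def by blast
      fix A assume A: "A \<subseteq> E"
      have "(\<Sum>e\<in>A. W e) \<le> (\<Sum>i=1..N. rank {e \<in> A. l e \<ge> i})"
        using ineq A unfolding level[OF A, symmetric] by blast
      also have "\<dots> \<le> (\<Sum>c\<in>C. rank {e \<in> A. c \<in> L e})"
        using A N size finite_subset[OF A finite_ground] \<open>finite C\<close>
        by (intro rank_level_sum_le) (auto simp: C_def has_list_size_def)
      finally show "(\<Sum>e\<in>A. W e) \<le> (\<Sum>c\<in>C. rank {e \<in> A. c \<in> L e})" .
    qed
  qed
  ultimately show ?thesis by blast
qed

end
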